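(* Let $(\xi_n)_{n=0}^\infty$ be a nonhomogeneous Markov chain on a probability space $(\Omega,\mathcal{F},\mathbb{P})$ with values in the finite state space $\mathbf{X}=\{1,2,\ldots,b\}$, with initial distribution $(\mu_0(1),\ldots,\mu_0(b))$ and transition matrices $P_n=(p_n(i,j))_{b\times b}$, $n\ge 1$, where $p_n(i,j)=\mathbb{P}(\xi_n=j\mid \xi_{n-1}=i)$. Let $(a_n)_{n=0}^\infty$ and $(\phi(n))_{n=0}^\infty$ be two sequences of nonnegative integers such that $\phi(n)\to\infty$ as $n\to\infty$. Let $(g_n(x,y))_{n=0}^\infty$ be a sequence of real functions defined on $\mathbf{X}\times\mathbf{X}$. Suppose that for every $\varepsilon>0$ $$\sum_{n=1}^\infty\exp[-\varepsilon\phi(n)]<\infty,$$ and that there exists a real number $0<\gamma<\infty$ such that $$\limsup_{n\to\infty}\frac{1}{\phi(n)}\sum_{k=a_n+1}^{a_n+\phi(n)}E\big[|g_k(\xi_{k-1},\xi_k)|^2e^{\gamma|g_k(\xi_{k-1},\xi_k)|}\,\big|\,\xi_{k-1}\big]=c(\gamma;\omega)<\infty\quad\text{almost everywhere.}$$ Then $$\lim_{n\to\infty}\frac{1}{\phi(n)}\sum_{k=a_n+1}^{a_n+\phi(n)}\big\{g_k(\xi_{k-1},\xi_k)-E[g_k(\xi_{k-1},\xi_k)\mid\xi_{k-1}]\big\}=0\quad\text{almost everywhere.}$$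
   Context: The ratios with denominator $\phi(n)$ are considered for those $n$ with $\phi(n)\ge 1$ (all sufficiently large $n$). *)

theory Defs
  imports "HOL-Probability.Probability"
begin

text \<open>
  The matrix entry \<open>p n i j\<close> is indexed as in $p_n(i,j) = P(\xi_n = j \mid \xi_{n-1} = i)$,
  so only \<open>p n\<close> with \<open>n \<ge> 1\<close> is relevant. Elementary conditional probabilities are constrained
  only where the conditioning event has positive probability; \<open>cond_prob\<close> is \<open>0\<close> on null events.
  No homogeneity is assumed: \<open>p n\<close> may depend on \<open>n\<close>.
\<close>

locale finite_nonhomogeneous_markov_chain = prob_space M
  for M :: "'a measure" +
  fixes b :: nat
    and \<mu>\<^sub>0 :: "nat \<Rightarrow> real"
    and p :: "nat \<Rightarrow> nat \<Rightarrow> nat \<Rightarrow> real"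
    and \<xi> :: "nat \<Rightarrow> 'a \<Rightarrow> nat"
  assumes random_variable_chain: "\<And>n. random_variable (count_space {1..b}) (\<xi> n)"
    and initial_distribution:
      "\<And>i. i \<in> {1..b} \<Longrightarrow> \<P>(\<omega> in M. \<xi> 0 \<omega> = i) = \<mu>\<^sub>0 i"
    and transition_nonneg:
      "\<And>n i j. n \<ge> 1 \<Longrightarrow> i \<in> {1..b} \<Longrightarrow> j \<in> {1..b} \<Longrightarrow> p n i j \<ge> 0"
    and transition_row_sum:
      "\<And>n i. n \<ge> 1 \<Longrightarrow> i \<in> {1..b} \<Longrightarrow> (\<Sum>j\<in>{1..b}. p n i j) = 1"
    and transition_prob:
      "\<And>n i j. n \<ge> 1 \<Longrightarrow> i \<in> {1..b} \<Longrightarrow> j \<in> {1..b} \<Longrightarrow>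
         \<P>(\<omega> in M. \<xi> (n - 1) \<omega> = i) > 0 \<Longrightarrow>
         \<P>(\<omega> in M. \<xi> n \<omega> = j \<bar> \<xi> (n - 1) \<omega> = i) = p n i j"
    and markov_property:
      "\<And>n x. n \<ge> 1 \<Longrightarrow> (\<forall>k\<le>n. x k \<in> {1..b}) \<Longrightarrow>
         \<P>(\<omega> in M. \<forall>k<n. \<xi> k \<omega> = x k) > 0 \<Longrightarrow>
         \<P>(\<omega> in M. \<xi> n \<omega> = x n \<bar> \<forall>k<n. \<xi> k \<omega> = x k) =
         \<P>(\<omega> in M. \<xi> n \<omega> = x n \<bar> \<xi> (n - 1) \<omega> = x (n - 1))"

text \<open>
  Conditional expectation of \<open>f\<close> given the sigma-algebra generated by \<open>X\<close>. The value space is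
  taken discrete, which gives the usual generated sigma-algebra for a discrete random variable.
\<close>

definition cond_exp_given :: "'a measure \<Rightarrow> ('a \<Rightarrow> nat) \<Rightarrow> ('a \<Rightarrow> real) \<Rightarrow> 'a \<Rightarrow> real" where
  "cond_exp_given M X f = real_cond_exp M (vimage_algebra (space M) X (count_space UNIV)) f"

end

theory Submission
  imports Defs
begin

text \<open>
  Write \<open>X\<^sub>k = g\<^sub>k(\<xi>\<^bsub>k-1\<^esub>, \<xi>\<^sub>k)\<close>, let \<open>D\<^sub>k\<close> be its centring given \<open>\<xi>\<^bsub>k-1\<^esub>\<close> and \<open>V\<^sub>k\<close> the conditional
  expectation of \<open>X\<^sub>k\<^sup>2 exp (\<gamma> |X\<^sub>k|)\<close>. For \<open>|t| \<le> \<gamma>\<close> the bound \<open>exp x \<le> 1 + x + x\<^sup>2/2 exp |x|\<close> shows that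
  \<open>exp (t D\<^sub>k - t\<^sup>2/2 V\<^sub>k)\<close> has conditional expectation at most 1, so by the Markov property the
  product of these factors over the block of length \<open>\<phi>(n)\<close> has expectation at most 1. Markov's
  inequality and Borel-Cantelli give \<open>t \<Sum>D\<^sub>k \<le> t\<^sup>2 \<phi>(n) + t\<^sup>2/2 \<Sum>V\<^sub>k\<close> eventually, almost surely.
  Since the averages of \<open>V\<^sub>k\<close> stay bounded, dividing by \<open>t \<phi>(n)\<close> for \<open>t = \<plusminus>\<gamma>/(N+1)\<close> and letting
  \<open>N \<rightarrow> \<infinity>\<close> gives the claim.
\<close>

section \<open>Exponential estimate and expectations over finite ranges\<close>

lemma exp_le_quadratic:
  fixes x :: real
  shows "exp x \<le> 1 + x + x\<^sup>2 / 2 * exp \<bar>x\<bar>"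
proof -
  obtain t where t: "\<bar>t\<bar> \<le> \<bar>x\<bar>" "exp x = (\<Sum>m<2. x ^ m / fact m) + exp t / fact 2 * x ^ 2"
    using Maclaurin_exp_le[of x 2] by blast
  have "exp t * x\<^sup>2 \<le> exp \<bar>x\<bar> * x\<^sup>2"
    using t(1) by (intro mult_right_mono) auto
  with t(2) show ?thesis
    by (simp add: numeral_2_eq_2 mult.commute)
qed

text \<open>At each point exactly one summand of the indicator expansion over \<open>S\<close>
  survives, so linearity suffices. Asking that level sets be events, rather than that
  \<open>Y\<close> be measurable into a chosen space, admits pairs of states and whole finite paths
  as \<open>Y\<close>.\<close>

lemma (in prob_space) expectation_finite_range:
  fixes F :: "'b \<Rightarrow> real"
  assumes fin: "finite S"
    and Y: "\<And>\<omega>. \<omega> \<in> space M \<Longrightarrow> Y \<omega> \<in> S"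
    and ev: "\<And>y. y \<in> S \<Longrightarrow> {\<omega> \<in> space M. Y \<omega> = y} \<in> events"
  shows "expectation (\<lambda>\<omega>. F (Y \<omega>)) = (\<Sum>y\<in>S. F y * \<P>(\<omega> in M. Y \<omega> = y))" (is ?E)
    and "integrable M (\<lambda>\<omega>. F (Y \<omega>))" (is ?I)
proof -
  let ?f = "\<lambda>\<omega>. \<Sum>y\<in>S. F y * indicator {\<omega> \<in> space M. Y \<omega> = y} \<omega>"
  have eq: "F (Y \<omega>) = ?f \<omega>" if "\<omega> \<in> space M" for \<omega>
    using that fin Y[OF that] by (simp add: indicator_def if_distrib sum.delta' cong: if_cong)
  have int: "integrable M (\<lambda>\<omega>. F y * indicator {\<omega> \<in> space M. Y \<omega> = y} \<omega> :: real)" if "y \<in> S" for y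
    using ev[OF that] by (intro integrable_mult_right integrable_real_indicator) (auto simp: emeasure_eq_measure)
  have "integrable M ?f"
    using int by (intro Bochner_Integration.integrable_sum) auto
  then show ?I
    using eq by (subst Bochner_Integration.integrable_cong[OF refl]) auto
  have "expectation (\<lambda>\<omega>. F (Y \<omega>)) = expectation ?f"
    using eq by (intro Bochner_Integration.integral_cong) auto
  also have "\<dots> = (\<Sum>y\<in>S. expectation (\<lambda>\<omega>. F y * indicator {\<omega> \<in> space M. Y \<omega> = y} \<omega>))"
    using int by (intro Bochner_Integration.integral_sum) auto
  also have "\<dots> = (\<Sum>y\<in>S. F y * \<P>(\<omega> in M. Y \<omega> = y))"
    using ev by (intro sum.cong) (simp_all add: sets.Int_space_eq2)
  finally show ?E .
qed

section \<open>Transition and path probabilities\<close>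

context finite_nonhomogeneous_markov_chain
begin

text \<open>For \<open>n \<ge> 1\<close> this is a version of the conditional expectation of
  \<open>f (\<xi> (n - 1)) (\<xi> n)\<close> given that the earlier state is \<open>i\<close>; being
  an explicit sum, it has a useful value at null states as well.\<close>

definition trans_exp :: "nat \<Rightarrow> (nat \<Rightarrow> nat \<Rightarrow> real) \<Rightarrow> nat \<Rightarrow> real" where
  "trans_exp n f i = (\<Sum>j\<in>{1..b}. p n i j * f i j)"

lemma chain_measurable [measurable]: "\<xi> n \<in> measurable M (count_space UNIV)"
  by (rule measurable_compose[OF random_variable_chain[of n], of "\<lambda>i. i"]) simp

lemma chain_in: "\<omega> \<in> space M \<Longrightarrow> \<xi> n \<omega> \<in> {1..b}"
  using measurable_space[OF random_variable_chain[of n]] by simp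

text \<open>The multiplied-out form of the transition law also covers states of probability zero,
  where both sides vanish, so sums over states need no case split later.\<close>

lemma step_prob:
  assumes "n \<ge> 1" "i \<in> {1..b}" "j \<in> {1..b}"
  shows "\<P>(\<omega> in M. \<xi> (n - 1) \<omega> = i \<and> \<xi> n \<omega> = j) = \<P>(\<omega> in M. \<xi> (n - 1) \<omega> = i) * p n i j"
proof (cases "\<P>(\<omega> in M. \<xi> (n - 1) \<omega> = i) > 0")
  case True
  then show ?thesis
    using transition_prob[OF assms True] by (simp add: cond_prob_def field_simps conj_commute)
next
  case False
  then have 0: "\<P>(\<omega> in M. \<xi> (n - 1) \<omega> = i) = 0"
    by (simp add: zero_less_measure_iff)
  have "\<P>(\<omega> in M. \<xi> (n - 1) \<omega> = i \<and> \<xi> n \<omega> = j) \<le> \<P>(\<omega> in M. \<xi> (n - 1) \<omega> = i)"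
    by (intro finite_measure_mono) auto
  with 0 show ?thesis
    by (simp add: antisym)
qed

text \<open>The Markov property replaces conditioning on the history by conditioning on its last
  state; for null histories both sides are zero.\<close>

lemma path_prob:
  assumes "n \<ge> 1" "x \<in> {..<n} \<rightarrow> {1..b}" "j \<in> {1..b}"
  shows "\<P>(\<omega> in M. (\<forall>k<n. \<xi> k \<omega> = x k) \<and> \<xi> n \<omega> = j) =
         \<P>(\<omega> in M. \<forall>k<n. \<xi> k \<omega> = x k) * p n (x (n - 1)) j"
proof (cases "\<P>(\<omega> in M. \<forall>k<n. \<xi> k \<omega> = x k) > 0")
  case True
  \<comment> \<open>\<open>markov_property\<close> reads the past and the next state off one
    sequence, so \<open>j\<close> is written into position \<open>n\<close>, leaving the past
    untouched.\<close>
  let ?x = "x(n := j)"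
  have eq: "(\<forall>k<n. \<xi> k \<omega> = ?x k) = (\<forall>k<n. \<xi> k \<omega> = x k)" for \<omega>
    by auto
  have "\<P>(\<omega> in M. \<xi> n \<omega> = ?x n \<bar> \<forall>k<n. \<xi> k \<omega> = ?x k) =
         \<P>(\<omega> in M. \<xi> n \<omega> = ?x n \<bar> \<xi> (n - 1) \<omega> = ?x (n - 1))"
    using assms True by (intro markov_property) (auto simp: eq)
  then have "\<P>(\<omega> in M. \<xi> n \<omega> = j \<bar> \<forall>k<n. \<xi> k \<omega> = x k) =
         \<P>(\<omega> in M. \<xi> n \<omega> = j \<bar> \<xi> (n - 1) \<omega> = x (n - 1))"
    using assms(1) by (simp add: eq split: if_splits)
  also have "\<dots> = p n (x (n - 1)) j"
  proof (rule transition_prob)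
    \<comment> \<open>A history of positive probability ends in a state of positive probability,
      which is the side condition of \<open>transition_prob\<close>.\<close>
    have "\<P>(\<omega> in M. \<forall>k<n. \<xi> k \<omega> = x k) \<le> \<P>(\<omega> in M. \<xi> (n - 1) \<omega> = x (n - 1))"
      using assms(1) by (intro finite_measure_mono) auto
    then show "\<P>(\<omega> in M. \<xi> (n - 1) \<omega> = x (n - 1)) > 0"
      using True by linarith
  qed (use assms in auto)
  finally show ?thesis
    using True by (simp add: cond_prob_def field_simps conj_commute)
next
  case False
  then have 0: "\<P>(\<omega> in M. \<forall>k<n. \<xi> k \<omega> = x k) = 0"
    by (simp add: zero_less_measure_iff)
  have "\<P>(\<omega> in M. (\<forall>k<n. \<xi> k \<omega> = x k) \<and> \<xi> n \<omega> = j) \<le> \<P>(\<omega> in M. \<forall>k<n. \<xi> k \<omega> = x k)"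
    by (intro finite_measure_mono) auto
  with 0 show ?thesis
    by (simp add: antisym)
qed

lemma expectation_pair:
  assumes "n \<ge> 1"
  shows "expectation (\<lambda>\<omega>. f (\<xi> (n - 1) \<omega>) (\<xi> n \<omega>)) = expectation (\<lambda>\<omega>. trans_exp n f (\<xi> (n - 1) \<omega>))"
    and "integrable M (\<lambda>\<omega>. f (\<xi> (n - 1) \<omega>) (\<xi> n \<omega>) :: real)"
proof -
  let ?Y = "\<lambda>\<omega>. (\<xi> (n - 1) \<omega>, \<xi> n \<omega>)"
  have fin: "finite ({1..b} \<times> {1..b})"
    by simp
  have Y: "?Y \<omega> \<in> {1..b} \<times> {1..b}" if "\<omega> \<in> space M" for \<omega>
    using chain_in[OF that] by blast
  have ev: "{\<omega> \<in> space M. ?Y \<omega> = y} \<in> events" for y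
    by (cases y) simp
  note ex = expectation_finite_range[OF fin Y ev, where F = "case_prod f"]
  show "integrable M (\<lambda>\<omega>. f (\<xi> (n - 1) \<omega>) (\<xi> n \<omega>) :: real)"
    using ex(2) by simp
  have ex1: "expectation (\<lambda>\<omega>. trans_exp n f (\<xi> (n - 1) \<omega>)) =
      (\<Sum>i\<in>{1..b}. trans_exp n f i * \<P>(\<omega> in M. \<xi> (n - 1) \<omega> = i))"
    by (rule expectation_finite_range[OF finite_atLeastAtMost chain_in]) measurable
  have "expectation (\<lambda>\<omega>. f (\<xi> (n - 1) \<omega>) (\<xi> n \<omega>)) =
      (\<Sum>i\<in>{1..b}. \<Sum>j\<in>{1..b}. f i j * \<P>(\<omega> in M. \<xi> (n - 1) \<omega> = i \<and> \<xi> n \<omega> = j))"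
    using ex(1) by (simp add: sum.cartesian_product case_prod_unfold prod_eq_iff)
  also have "\<dots> = (\<Sum>i\<in>{1..b}. trans_exp n f i * \<P>(\<omega> in M. \<xi> (n - 1) \<omega> = i))"
    unfolding trans_exp_def sum_distrib_right
    using assms by (intro sum.cong refl) (simp add: step_prob del: One_nat_def)
  finally show "expectation (\<lambda>\<omega>. f (\<xi> (n - 1) \<omega>) (\<xi> n \<omega>)) =
      expectation (\<lambda>\<omega>. trans_exp n f (\<xi> (n - 1) \<omega>))"
    by (simp only: ex1)
qed

section \<open>Conditional expectations as transition sums\<close>

text \<open>The test sets are preimages of sets \<open>B\<close> of states. The indicator of
  \<open>B\<close> depends on the first argument of \<open>f\<close> only, so it can be absorbed
  into \<open>f\<close>, and \<open>expectation_pair\<close> yields the characterizing integral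
  identity.\<close>

lemma cond_exp_given_chain:
  assumes "n \<ge> 1"
  shows "AE \<omega> in M. cond_exp_given M (\<xi> (n - 1)) (\<lambda>\<omega>. f (\<xi> (n - 1) \<omega>) (\<xi> n \<omega>)) \<omega>
           = trans_exp n f (\<xi> (n - 1) \<omega>)"
proof -
  let ?F = "vimage_algebra (space M) (\<xi> (n - 1)) (count_space UNIV)"
  have sub: "subalgebra M ?F"
    unfolding subalgebra_def by (auto simp: sets_vimage_algebra2 intro: measurable_sets[OF chain_measurable])
  interpret finite_measure_subalgebra M ?F
    by unfold_locales (rule sub)
  have meas: "\<xi> (n - 1) \<in> measurable ?F (count_space UNIV)"
    by (rule measurable_vimage_algebra1) auto
  show ?thesis
    unfolding cond_exp_given_def
  proof (rule real_cond_exp_charact)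
    fix A assume "A \<in> sets ?F"
    then obtain B where A: "A = \<xi> (n - 1) -` B \<inter> space M"
      by (auto simp: sets_vimage_algebra2)
    have "(LINT \<omega>:A|M. f (\<xi> (n - 1) \<omega>) (\<xi> n \<omega>)) =
        expectation (\<lambda>\<omega>. (\<lambda>i j. indicator B i * f i j) (\<xi> (n - 1) \<omega>) (\<xi> n \<omega>))"
      unfolding set_lebesgue_integral_def A
      by (intro Bochner_Integration.integral_cong) (auto simp: indicator_def)
    also have "\<dots> = expectation (\<lambda>\<omega>. trans_exp n (\<lambda>i j. indicator B i * f i j) (\<xi> (n - 1) \<omega>))"
      by (rule expectation_pair(1)[OF assms])
    also have "\<dots> = (LINT \<omega>:A|M. trans_exp n f (\<xi> (n - 1) \<omega>))"
      unfolding set_lebesgue_integral_def A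
      by (intro Bochner_Integration.integral_cong) (auto simp: indicator_def trans_exp_def)
    finally show "(LINT \<omega>:A|M. f (\<xi> (n - 1) \<omega>) (\<xi> n \<omega>)) = (LINT \<omega>:A|M. trans_exp n f (\<xi> (n - 1) \<omega>))" .
  next
    show "integrable M (\<lambda>\<omega>. f (\<xi> (n - 1) \<omega>) (\<xi> n \<omega>))"
      by (rule expectation_pair(2)[OF assms])
    show "integrable M (\<lambda>\<omega>. trans_exp n f (\<xi> (n - 1) \<omega>))"
      using expectation_pair(2)[OF assms, of "\<lambda>i _. trans_exp n f i"] .
    show "(\<lambda>\<omega>. trans_exp n f (\<xi> (n - 1) \<omega>)) \<in> borel_measurable ?F"
      using meas by (rule measurable_compose) simp
  qed
qed

section \<open>Exponential supermartingale bound over a block\<close>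

text \<open>One supermartingale step: given the history, the new factor has mean at most 1, and
  \<open>F\<close> is a nonnegative weight. Restricting the path to \<open>{..<n}\<close> makes
  \<open>F\<close> a function of the past with finitely many relevant arguments.\<close>

lemma expectation_path_step_le:
  fixes F :: "(nat \<Rightarrow> nat) \<Rightarrow> real"
  assumes n: "n \<ge> 1" and F: "\<And>x. F x \<ge> 0"
    and q: "\<And>i. i \<in> {1..b} \<Longrightarrow> trans_exp n q i \<le> 1"
  shows "expectation (\<lambda>\<omega>. F (restrict (\<lambda>k. \<xi> k \<omega>) {..<n}) * q (\<xi> (n - 1) \<omega>) (\<xi> n \<omega>))
           \<le> expectation (\<lambda>\<omega>. F (restrict (\<lambda>k. \<xi> k \<omega>) {..<n}))"
    and "integrable M (\<lambda>\<omega>. F (restrict (\<lambda>k. \<xi> k \<omega>) {..<n}))"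
proof -
  let ?R = "\<lambda>\<omega>. restrict (\<lambda>k. \<xi> k \<omega>) {..<n}"
  let ?S = "{..<n} \<rightarrow>\<^sub>E {1..b}"
  have fin: "finite ?S"
    by (intro finite_PiE) auto
  have R: "?R \<omega> \<in> ?S" if "\<omega> \<in> space M" for \<omega>
    using chain_in[OF that] by auto
  \<comment> \<open>Both sides are extensional, so equality of restricted paths is agreement below
    \<open>n\<close>, the event treated by \<open>path_prob\<close>.\<close>
  have R_eq: "?R \<omega> = x \<longleftrightarrow> (\<forall>k<n. \<xi> k \<omega> = x k)" if "x \<in> ?S" for \<omega> x
    using that by (auto simp: fun_eq_iff PiE_def extensional_def restrict_def)
  have evR: "{\<omega> \<in> space M. ?R \<omega> = x} \<in> events" if "x \<in> ?S" for x
    unfolding R_eq[OF that] by measurable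
  note exR = expectation_finite_range[OF fin R evR, where F = F]
  show "integrable M (\<lambda>\<omega>. F (?R \<omega>))"
    by (rule exR(2))
  let ?Y = "\<lambda>\<omega>. (?R \<omega>, \<xi> n \<omega>)"
  have evY: "{\<omega> \<in> space M. ?Y \<omega> = y} \<in> events" if "y \<in> ?S \<times> {1..b}" for y
  proof -
    have "{\<omega> \<in> space M. ?Y \<omega> = y} = {\<omega> \<in> space M. (\<forall>k<n. \<xi> k \<omega> = fst y k) \<and> \<xi> n \<omega> = snd y}"
      using R_eq[of "fst y"] that by (auto simp: prod_eq_iff)
    then show ?thesis by simp
  qed
  have Y: "?Y \<omega> \<in> ?S \<times> {1..b}" if "\<omega> \<in> space M" for \<omega>
    using R[OF that] chain_in[OF that] by blast
  have "expectation (\<lambda>\<omega>. F (?R \<omega>) * q (\<xi> (n - 1) \<omega>) (\<xi> n \<omega>)) =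
      expectation (\<lambda>\<omega>. (\<lambda>(x, j). F x * q (x (n - 1)) j) (?Y \<omega>))"
    using n by simp
  also have "\<dots> = (\<Sum>y\<in>?S \<times> {1..b}. (\<lambda>(x, j). F x * q (x (n - 1)) j) y * \<P>(\<omega> in M. ?Y \<omega> = y))"
    by (rule expectation_finite_range[OF _ Y evY]) (use fin in auto)
  also have "\<dots> = (\<Sum>x\<in>?S. \<Sum>j\<in>{1..b}. F x * q (x (n - 1)) j * \<P>(\<omega> in M. ?R \<omega> = x \<and> \<xi> n \<omega> = j))"
    by (simp add: sum.cartesian_product case_prod_unfold prod_eq_iff)
  also have "\<dots> = (\<Sum>x\<in>?S. F x * \<P>(\<omega> in M. ?R \<omega> = x) * trans_exp n q (x (n - 1)))"
    unfolding trans_exp_def sum_distrib_left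
  proof (intro sum.cong refl)
    fix x j assume x: "x \<in> ?S" and j: "j \<in> {1..b}"
    show "F x * q (x (n - 1)) j * \<P>(\<omega> in M. ?R \<omega> = x \<and> \<xi> n \<omega> = j) =
        F x * \<P>(\<omega> in M. ?R \<omega> = x) * (p n (x (n - 1)) j * q (x (n - 1)) j)"
      unfolding R_eq[OF x] using path_prob[OF n _ j, of x] x by (simp add: PiE_def)
  qed
  also have "\<dots> \<le> (\<Sum>x\<in>?S. F x * \<P>(\<omega> in M. ?R \<omega> = x) * 1)"
  proof (intro sum_mono mult_left_mono)
    fix x assume "x \<in> ?S"
    then have "x (n - 1) \<in> {1..b}"
      by (rule PiE_mem) (use n in simp)
    then show "trans_exp n q (x (n - 1)) \<le> 1"
      by (rule q)
  qed (intro mult_nonneg_nonneg F measure_nonneg)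
  also have "\<dots> = expectation (\<lambda>\<omega>. F (?R \<omega>))"
    by (simp only: exR(1) mult_1_right)
  finally show "expectation (\<lambda>\<omega>. F (?R \<omega>) * q (\<xi> (n - 1) \<omega>) (\<xi> n \<omega>)) \<le> expectation (\<lambda>\<omega>. F (?R \<omega>))" .
qed

text \<open>Induction on the block length: each supermartingale step removes the last factor, down
  to the empty product 1.\<close>

lemma expectation_exp_block_le_1:
  fixes h :: "nat \<Rightarrow> nat \<Rightarrow> nat \<Rightarrow> real"
  assumes h: "\<And>k i. k \<ge> 1 \<Longrightarrow> i \<in> {1..b} \<Longrightarrow> trans_exp k (\<lambda>i j. exp (h k i j)) i \<le> 1"
  shows "expectation (\<lambda>\<omega>. exp (\<Sum>k=c+1..c+m. h k (\<xi> (k - 1) \<omega>) (\<xi> k \<omega>))) \<le> 1"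
    and "integrable M (\<lambda>\<omega>. exp (\<Sum>k=c+1..c+m. h k (\<xi> (k - 1) \<omega>) (\<xi> k \<omega>)))"
proof -
  define F where "F m x = exp (\<Sum>k=c+1..c+m. h k (x (k - 1)) (x k))" for m and x :: "nat \<Rightarrow> nat"
  \<comment> \<open>The sum stops at \<open>c + m\<close>, so it reads only the past of time
    \<open>c + m + 1\<close>, the time of the next factor.\<close>
  have F_restrict: "F m (restrict x {..<c + m + 1}) = F m x" for m x
    unfolding F_def by (intro arg_cong[where f = exp] sum.cong) auto
  have F_nonneg: "F m x \<ge> 0" for m x
    by (simp add: F_def)
  have q: "trans_exp (c + m + 1) (\<lambda>i j. exp (h (c + m + 1) i j)) i \<le> 1" if "i \<in> {1..b}" for m i
    using that by (intro h) auto
  have step: "expectation (\<lambda>\<omega>. F m (\<lambda>k. \<xi> k \<omega>) * exp (h (c + m + 1) (\<xi> (c + m + 1 - 1) \<omega>) (\<xi> (c + m + 1) \<omega>)))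
        \<le> expectation (\<lambda>\<omega>. F m (\<lambda>k. \<xi> k \<omega>))"
    and int: "integrable M (\<lambda>\<omega>. F m (\<lambda>k. \<xi> k \<omega>))" for m
    using expectation_path_step_le[of "c + m + 1" "F m", OF le_add2 F_nonneg q]
    unfolding F_restrict by blast+
  have "expectation (\<lambda>\<omega>. F m (\<lambda>k. \<xi> k \<omega>)) \<le> 1"
  proof (induction m)
    case 0
    then show ?case
      by (simp add: F_def prob_space)
  next
    case (Suc m)
    let ?n = "c + m + 1"
    have "F (Suc m) x = F m x * exp (h ?n (x (?n - 1)) (x ?n))" for x
      by (simp add: F_def exp_add[symmetric])
    then have "expectation (\<lambda>\<omega>. F (Suc m) (\<lambda>k. \<xi> k \<omega>)) \<le> expectation (\<lambda>\<omega>. F m (\<lambda>k. \<xi> k \<omega>))"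
      using step[of m] by (simp only:)
    with Suc.IH show ?case
      by linarith
  qed
  then show "expectation (\<lambda>\<omega>. exp (\<Sum>k=c+1..c+m. h k (\<xi> (k - 1) \<omega>) (\<xi> k \<omega>))) \<le> 1"
    by (simp add: F_def)
  show "integrable M (\<lambda>\<omega>. exp (\<Sum>k=c+1..c+m. h k (\<xi> (k - 1) \<omega>) (\<xi> k \<omega>)))"
    using int[of m] by (simp add: F_def)
qed

text \<open>Averaging the quadratic bound over a row of total mass 1 gives \<open>1 + s\<close>,
  where \<open>s\<close> is \<open>t\<close> times the mean plus half of \<open>t\<^sup>2\<close>
  times the weighted second moment. Since \<open>1 + s \<le> exp s\<close>, the factor
  \<open>exp (- s)\<close> compensates exactly.\<close>

lemma trans_exp_compensated_le_1:
  fixes f :: "nat \<Rightarrow> nat \<Rightarrow> real"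
  assumes n: "n \<ge> 1" and i: "i \<in> {1..b}" and t: "\<bar>t\<bar> \<le> \<gamma>"
  shows "trans_exp n (\<lambda>i j. exp (t * (f i j - trans_exp n f i)
           - t\<^sup>2 / 2 * trans_exp n (\<lambda>i j. \<bar>f i j\<bar>\<^sup>2 * exp (\<gamma> * \<bar>f i j\<bar>)) i)) i \<le> 1"
proof -
  define e where "e = trans_exp n f i"
  define v where "v = trans_exp n (\<lambda>i j. \<bar>f i j\<bar>\<^sup>2 * exp (\<gamma> * \<bar>f i j\<bar>)) i"
  let ?s = "t * e + t\<^sup>2 / 2 * v"
  have pt: "exp (t * f i j) \<le> 1 + t * f i j + t\<^sup>2 / 2 * (\<bar>f i j\<bar>\<^sup>2 * exp (\<gamma> * \<bar>f i j\<bar>))" for j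
  proof -
    \<comment> \<open>The restriction on \<open>t\<close> enters here: the exponential in the
      remainder is dominated by the weight with \<gamma>, uniformly in \<open>t\<close>.\<close>
    have "\<bar>t * f i j\<bar> \<le> \<gamma> * \<bar>f i j\<bar>"
      using t by (simp add: abs_mult mult_right_mono)
    then have "(t * f i j)\<^sup>2 / 2 * exp \<bar>t * f i j\<bar> \<le> (t * f i j)\<^sup>2 / 2 * exp (\<gamma> * \<bar>f i j\<bar>)"
      by (intro mult_left_mono) auto
    with exp_le_quadratic[of "t * f i j"] show ?thesis
      by (simp add: power_mult_distrib)
  qed
  have "(\<Sum>j\<in>{1..b}. p n i j * exp (t * f i j)) \<le>
      (\<Sum>j\<in>{1..b}. p n i j * (1 + t * f i j + t\<^sup>2 / 2 * (\<bar>f i j\<bar>\<^sup>2 * exp (\<gamma> * \<bar>f i j\<bar>))))"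
    using pt transition_nonneg[OF n i] by (intro sum_mono mult_left_mono) auto
  also have "\<dots> = 1 + ?s"
    using transition_row_sum[OF n i]
    by (simp add: e_def v_def trans_exp_def algebra_simps sum.distrib sum_distrib_left)
  also have "\<dots> \<le> exp ?s"
    by (rule exp_ge_add_one_self)
  finally have le: "(\<Sum>j\<in>{1..b}. p n i j * exp (t * f i j)) \<le> exp ?s" .
  have "trans_exp n (\<lambda>i j. exp (t * (f i j - trans_exp n f i)
           - t\<^sup>2 / 2 * trans_exp n (\<lambda>i j. \<bar>f i j\<bar>\<^sup>2 * exp (\<gamma> * \<bar>f i j\<bar>)) i)) i
      = (\<Sum>j\<in>{1..b}. p n i j * (exp (t * f i j) * exp (- ?s)))"
    unfolding trans_exp_def[of n "\<lambda>i j. exp (_ i j)"] e_def v_def exp_add[symmetric]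
    by (simp add: algebra_simps)
  also have "\<dots> = (\<Sum>j\<in>{1..b}. p n i j * exp (t * f i j)) * exp (- ?s)"
    by (simp add: sum_distrib_right mult.assoc)
  also have "\<dots> \<le> exp ?s * exp (- ?s)"
    using le by (intro mult_right_mono) auto
  finally show ?thesis
    by (simp add: exp_add[symmetric])
qed

section \<open>Almost sure bounds on block sums\<close>

text \<open>Markov's inequality for the exponential of the block sum bounds each exceedance
  probability by a summable term. The first Borel-Cantelli lemma then applies however the blocks
  overlap.\<close>

lemma AE_eventually_block_le:
  fixes h :: "nat \<Rightarrow> nat \<Rightarrow> nat \<Rightarrow> real"
  assumes h: "\<And>k i. k \<ge> 1 \<Longrightarrow> i \<in> {1..b} \<Longrightarrow> trans_exp k (\<lambda>i j. exp (h k i j)) i \<le> 1"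
    and sum: "summable (\<lambda>n. exp (- \<epsilon> * real (\<phi> (Suc n))))"
  shows "AE \<omega> in M. eventually (\<lambda>n.
           (\<Sum>k=a n+1..a n+\<phi> n. h k (\<xi> (k - 1) \<omega>) (\<xi> k \<omega>)) \<le> \<epsilon> * real (\<phi> n)) sequentially"
proof -
  define S where "S n \<omega> = (\<Sum>k=a n+1..a n+\<phi> n. h k (\<xi> (k - 1) \<omega>) (\<xi> k \<omega>))" for n \<omega>
  have [measurable]: "S n \<in> borel_measurable M" for n
  proof -
    have "(\<lambda>\<omega>. h k (\<xi> (k - 1) \<omega>) (\<xi> k \<omega>)) \<in> borel_measurable M" if "k \<ge> 1" for k
      using expectation_pair(2)[OF that, of "h k"] by (rule borel_measurable_integrable)
    then show ?thesis
      unfolding S_def by (intro borel_measurable_sum) auto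
  qed
  let ?A = "\<lambda>n. {\<omega> \<in> space M. S n \<omega> > \<epsilon> * real (\<phi> n)}"
  have bound: "prob (?A n) \<le> exp (- \<epsilon> * real (\<phi> n))" for n
  proof -
    have int: "integrable M (\<lambda>\<omega>. exp (S n \<omega>))" and le: "expectation (\<lambda>\<omega>. exp (S n \<omega>)) \<le> 1"
      unfolding S_def using expectation_exp_block_le_1[OF h] by blast+
    have "prob (?A n) \<le> prob {\<omega> \<in> space M. exp (S n \<omega>) \<ge> exp (\<epsilon> * real (\<phi> n))}"
      by (intro finite_measure_mono) auto
    also have "\<dots> \<le> expectation (\<lambda>\<omega>. exp (S n \<omega>)) / exp (\<epsilon> * real (\<phi> n))"
      by (intro integral_Markov_inequality_measure[OF int, of "{}"]) auto
    also have "\<dots> \<le> 1 / exp (\<epsilon> * real (\<phi> n))"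
      using le by (intro divide_right_mono) auto
    finally show ?thesis
      by (simp add: exp_minus field_simps)
  qed
  have "summable (\<lambda>n. prob (?A n))"
  proof (rule summable_comparison_test')
    \<comment> \<open>The assumed series starts at index 1; the extra term at 0 does not affect
      convergence.\<close>
    show "summable (\<lambda>n. exp (- \<epsilon> * real (\<phi> n)))"
      using sum by (subst (asm) summable_Suc_iff)
    show "norm (prob (?A n)) \<le> exp (- \<epsilon> * real (\<phi> n))" if "n \<ge> 0" for n
      using bound[of n] by simp
  qed
  then have "AE \<omega> in M. eventually (\<lambda>n. \<omega> \<in> space M - ?A n) sequentially"
    by (intro borel_cantelli_AE1) (auto simp: emeasure_eq_measure)
  then show ?thesis
    by eventually_elim (auto simp: S_def elim!: eventually_mono)
qed

end

section \<open>Passage to the limit\<close>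

theorem lemma1:
  fixes M :: "'a measure"
    and b :: nat
    and \<mu>\<^sub>0 :: "nat \<Rightarrow> real"
    and p :: "nat \<Rightarrow> nat \<Rightarrow> nat \<Rightarrow> real"
    and \<xi> :: "nat \<Rightarrow> 'a \<Rightarrow> nat"
    and a \<phi> :: "nat \<Rightarrow> nat"
    and g :: "nat \<Rightarrow> nat \<Rightarrow> nat \<Rightarrow> real"
    and \<gamma> :: real
  assumes "finite_nonhomogeneous_markov_chain M b \<mu>\<^sub>0 p \<xi>"
    and "filterlim \<phi> at_top sequentially"
    and "\<And>\<epsilon>::real. \<epsilon> > 0 \<Longrightarrow> summable (\<lambda>n. exp (- \<epsilon> * real (\<phi> (Suc n))))"
    and "\<gamma> > 0"
    and "AE \<omega> in M.
           limsup (\<lambda>n. ereal (1 / real (\<phi> n) *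
             (\<Sum>k = a n + 1..a n + \<phi> n.
               cond_exp_given M (\<xi> (k - 1))
                 (\<lambda>\<omega>'. \<bar>g k (\<xi> (k - 1) \<omega>') (\<xi> k \<omega>')\<bar>\<^sup>2
                        * exp (\<gamma> * \<bar>g k (\<xi> (k - 1) \<omega>') (\<xi> k \<omega>')\<bar>)) \<omega>))) < \<infinity>"
  shows "AE \<omega> in M.
           (\<lambda>n. 1 / real (\<phi> n) *
             (\<Sum>k = a n + 1..a n + \<phi> n.
               g k (\<xi> (k - 1) \<omega>) (\<xi> k \<omega>)
               - cond_exp_given M (\<xi> (k - 1))
                   (\<lambda>\<omega>'. g k (\<xi> (k - 1) \<omega>') (\<xi> k \<omega>')) \<omega>))
           \<longlonglongrightarrow> 0"
proof -
  interpret finite_nonhomogeneous_markov_chain M b \<mu>\<^sub>0 p \<xi>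
    by (rule assms(1))
  define w where "w k i j = \<bar>g k i j\<bar>\<^sup>2 * exp (\<gamma> * \<bar>g k i j\<bar>)" for k i j
  define SD where "SD n \<omega> = (\<Sum>k=a n+1..a n+\<phi> n.
      g k (\<xi> (k - 1) \<omega>) (\<xi> k \<omega>) - trans_exp k (g k) (\<xi> (k - 1) \<omega>))" for n \<omega>
  define SV where "SV n \<omega> = (\<Sum>k=a n+1..a n+\<phi> n. trans_exp k (w k) (\<xi> (k - 1) \<omega>))" for n \<omega>
  \<comment> \<open>Countably many exceptional sets are merged into one. Indices from 1 suffice
    because every block starts at \<open>a n + 1\<close>.\<close>
  have ce: "AE \<omega> in M. \<forall>k\<ge>1. cond_exp_given M (\<xi> (k - 1)) (\<lambda>\<omega>. f k (\<xi> (k - 1) \<omega>) (\<xi> k \<omega>)) \<omega>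
      = trans_exp k (f k) (\<xi> (k - 1) \<omega>)" for f
    unfolding AE_all_countable using cond_exp_given_chain by auto
  \<comment> \<open>The tolerance is taken to be \<open>t\<^sup>2\<close>, so that after division by
    the absolute value of \<open>t\<close> both error terms are of first order in
    \<open>t\<close>.\<close>
  have main: "AE \<omega> in M. eventually (\<lambda>n. t * SD n \<omega> \<le> t\<^sup>2 * real (\<phi> n) + t\<^sup>2 / 2 * SV n \<omega>) sequentially"
    if t: "t \<noteq> 0" "\<bar>t\<bar> \<le> \<gamma>" for t
  proof -
    define h where "h k i j = t * (g k i j - trans_exp k (g k) i) - t\<^sup>2 / 2 * trans_exp k (w k) i" for k i j
    have h_sum: "(\<Sum>k=a n+1..a n+\<phi> n. h k (\<xi> (k - 1) \<omega>) (\<xi> k \<omega>)) = t * SD n \<omega> - t\<^sup>2 / 2 * SV n \<omega>"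
      for n \<omega>
      unfolding h_def SD_def SV_def by (subst sum_subtractf) (simp only: sum_distrib_left)
    have "trans_exp k (\<lambda>i j. exp (h k i j)) i \<le> 1" if "k \<ge> 1" "i \<in> {1..b}" for k i
      unfolding h_def w_def[abs_def] using trans_exp_compensated_le_1[OF that t(2), of "g k"] .
    moreover have "summable (\<lambda>n. exp (- t\<^sup>2 * real (\<phi> (Suc n))))"
      using t(1) by (intro assms(3)) simp
    ultimately have "AE \<omega> in M. eventually (\<lambda>n. t * SD n \<omega> - t\<^sup>2 / 2 * SV n \<omega> \<le> t\<^sup>2 * real (\<phi> n)) sequentially"
      unfolding h_sum[symmetric] by (rule AE_eventually_block_le)
    then show ?thesis
      by (simp only: diff_le_eq)
  qed
  \<comment> \<open>A sequence tending to 0 within the admissible range: countably many parameters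
    allow all inequalities to hold on one almost sure event.\<close>
  define r where "r N = \<gamma> / real (Suc N)" for N
  have r: "r N > 0" "r N \<le> \<gamma>" for N
    using \<open>\<gamma> > 0\<close> by (auto simp: r_def field_simps)
  have "AE \<omega> in M. \<forall>N. eventually (\<lambda>n. r N * \<bar>SD n \<omega>\<bar> \<le> (r N)\<^sup>2 * real (\<phi> n) + (r N)\<^sup>2 / 2 * SV n \<omega>) sequentially"
    unfolding AE_all_countable
  proof
    fix N
    \<comment> \<open>Using both signs of the parameter bounds the absolute value of
      \<open>SD\<close>.\<close>
    have "r N \<noteq> 0" "\<bar>r N\<bar> \<le> \<gamma>" "- r N \<noteq> 0" "\<bar>- r N\<bar> \<le> \<gamma>"
      using r[of N] by auto
    from main[OF this(1,2)] main[OF this(3,4)]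
    show "AE \<omega> in M. eventually (\<lambda>n. r N * \<bar>SD n \<omega>\<bar> \<le> (r N)\<^sup>2 * real (\<phi> n) + (r N)\<^sup>2 / 2 * SV n \<omega>) sequentially"
    proof eventually_elim
      case (elim \<omega>)
      from elim show ?case
        by eventually_elim (auto simp: abs_if)
    qed
  qed
  with assms(5) ce[of g] ce[of w] show ?thesis
  proof eventually_elim
    case (elim \<omega>)
    have eq: "(\<Sum>k=a n+1..a n+\<phi> n. g k (\<xi> (k - 1) \<omega>) (\<xi> k \<omega>) - cond_exp_given M (\<xi> (k - 1))
                   (\<lambda>\<omega>'. g k (\<xi> (k - 1) \<omega>') (\<xi> k \<omega>')) \<omega>) = SD n \<omega>" for n
      unfolding SD_def using elim(2) by (intro sum.cong) auto
    have eqV: "(\<Sum>k=a n+1..a n+\<phi> n. cond_exp_given M (\<xi> (k - 1))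
                   (\<lambda>\<omega>'. w k (\<xi> (k - 1) \<omega>') (\<xi> k \<omega>')) \<omega>) = SV n \<omega>" for n
      unfolding SV_def using elim(3) by (intro sum.cong) auto
    have "limsup (\<lambda>n. ereal (1 / real (\<phi> n) * SV n \<omega>)) < \<infinity>"
      using elim(1) eqV unfolding w_def by simp
    \<comment> \<open>A limsup below infinity lies strictly below some real number, which becomes an
      eventual bound on the averages.\<close>
    then obtain C0 where C0: "limsup (\<lambda>n. ereal (1 / real (\<phi> n) * SV n \<omega>)) < ereal C0"
      using ereal_dense2 by blast
    define C where "C = max C0 0"
    have bdd: "eventually (\<lambda>n. 1 / real (\<phi> n) * SV n \<omega> \<le> C) sequentially"
      using Limsup_lessD[OF C0] by eventually_elim (auto simp: C_def)
    have pos: "eventually (\<lambda>n. \<phi> n \<ge> 1) sequentially"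
      using assms(2) by (auto simp: filterlim_at_top)
    show ?case
      unfolding eq
    proof (rule tendstoI)
      fix e :: real assume e: "e > 0"
      \<comment> \<open>This is the sum of both error terms after division by
        \<open>r N * \<phi> n\<close>. As \<open>C\<close> depends on \<omega>, so does the
        \<open>N\<close> chosen below, which is why the bounds were secured for all \<open>N\<close>
        at once.\<close>
      have "(\<lambda>N. r N * (1 + C / 2)) \<longlonglongrightarrow> 0"
        unfolding r_def using LIMSEQ_inverse_real_of_nat[THEN tendsto_mult_right_zero, of "\<gamma> * (1 + C / 2)"]
        by (simp add: field_simps)
      then have "eventually (\<lambda>N. r N * (1 + C / 2) < e) sequentially"
        using e by (rule order_tendstoD)
      then obtain N where N: "r N * (1 + C / 2) < e"
        by (auto simp: eventually_sequentially)
      show "eventually (\<lambda>n. dist (1 / real (\<phi> n) * SD n \<omega>) 0 < e) sequentially"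
        using bdd pos elim(4)[rule_format, of N]
      proof eventually_elim
        case (elim n)
        have \<phi>: "real (\<phi> n) > 0"
          using elim(2) by simp
        have "SV n \<omega> \<le> C * real (\<phi> n)"
          using elim(1) \<phi> by (simp add: field_simps)
        then have "(r N)\<^sup>2 / 2 * SV n \<omega> \<le> (r N)\<^sup>2 / 2 * (C * real (\<phi> n))"
          by (intro mult_left_mono) auto
        with elim(3) have "r N * \<bar>SD n \<omega>\<bar> \<le> r N * (r N * (1 + C / 2) * real (\<phi> n))"
          by (simp add: power2_eq_square algebra_simps)
        then have "\<bar>SD n \<omega>\<bar> \<le> r N * (1 + C / 2) * real (\<phi> n)"
          using r(1)[of N] by (simp only: mult_le_cancel_left_pos)
        also have "\<dots> < e * real (\<phi> n)"
          using N \<phi> by (rule mult_strict_right_mono)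
        finally show ?case
          using \<phi> by (simp add: field_simps abs_mult)
      qed
    qed
  qed
qed

end
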